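(* Let $A=(c_{ij}x^{\alpha_{ij}})$ be a multigraded squarefree $s\times l$ matrix over $R=\Bbbk[x_1,\ldots,x_n]$, $T=(\gamma_1,\ldots,\gamma_l,\beta_1,\ldots,\beta_s)$ a squarefree solution of $E_A$, and $M_T=\mathrm{Coker}\,\phi_T$. There exist simplicial complexes $\Delta_1,\ldots,\Delta_s$ on $[n]$ such that: (1) the set $B(M_T)=\{\overline{x^{\beta}v_i}:\ \beta\in\mathbb N^n,\ \mathrm{supp}(\beta)\in\Delta_i,\ i\in[s]\}$ is a $\Bbbk$-basis of $M_T$; (2) if $i\in[s]$, $\alpha\in\mathbb N^n$ and $\mathrm{supp}(\alpha)\notin\Delta_i$, then for each $j<i$ there are unique $r_{i,j,\alpha}\in\Bbbk$ such that $r_{i,j,\alpha}=0$ whenever $\alpha+\beta_i-\beta_j\notin\mathbb N^n$ or $\mathrm{supp}(\alpha+\beta_i-\beta_j)\notin\Delta_j$, and $$\overline{x^{\alpha}v_i}=\sum_{j<i}r_{i,j,\alpha}\ \overline{x^{\alpha+\beta_i-\beta_j}v_j}$$ (terms with coefficient $0$ being omitted).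
   Context: $\Bbbk$ is a field of characteristic $0$, $R=\Bbbk[x_1,\ldots,x_n]$, $[t]=\{1,\ldots,t\}$, $x^\alpha=x_1^{a_1}\cdots x_n^{a_n}$ and $\mathrm{supp}(\alpha)=\{i:a_i\ne0\}$ for $\alpha=(a_1,\dots,a_n)$. A vector is squarefree if it lies in $\{0,1\}^n$; a collection of vectors is squarefree if each of its vectors is. A simplicial complex on $[n]$ is a collection of subsets of $[n]$ closed under taking subsets; the void collection $\{\}$ is allowed. An $s\times l$ matrix $A=(c_{ij}x^{\alpha_{ij}})$ with $c_{ij}\in\Bbbk$, $\alpha_{ij}\in\mathbb N^n$ is multigraded if every minor of $A$ equals $c\,x^{\alpha}$ for some $c\in\Bbbk$ (possibly $0$) and some $\alpha\in\mathbb N^n$. The system $E_A$ consists of the equations $\gamma_j-\beta_i=\alpha_{ij}$, one for each $(i,j)$ with $c_{ij}\ne0$, in the unknown vectors $\gamma_1,\ldots,\gamma_l,\beta_1,\ldots,\beta_s$. A multigraded matrix $A$ is squarefree if $E_A$ has a squarefree solution. For a solution $T$, $F_1$ and $F_0$ are the multigraded free $R$-modules with bases $\{w_j:j\in[l]\}$, $\deg w_j=\gamma_j$, and $\{v_i:i\in[s]\}$, $\deg v_i=\beta_i$; $\phi_T:F_1\to F_0$ is $\phi_T(w_j)=\sum_i c_{ij}x^{\alpha_{ij}}v_i$; and $M_T=\mathrm{Coker}\,\phi_T$. For $g\in F_0$, $\overline g$ denotes $g+\mathrm{Im}\,\phi_T\in M_T$. *)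

theory Defs
  imports
    "Jordan_Normal_Form.VS_Connect"
    "Jordan_Normal_Form.DL_Submatrix"
    "HOL-Library.Poly_Mapping"
    "HOL-Algebra.AbelCoset"
begin

hide_const (open) Multiset.mult

text \<open>
  The variables are indexed by a finite type \<open>'n\<close>, which plays the role of $[n]$. Rows, columns
  and basis vectors are numbered from \<open>0\<close>, following \<open>Jordan_Normal_Form.Matrix\<close>.
\<close>

type_synonym 'n expo = "'n \<Rightarrow>\<^sub>0 nat"
type_synonym ('n, 'k) mpol = "'n expo \<Rightarrow>\<^sub>0 'k"

definition squarefree_expo :: "'n expo \<Rightarrow> bool" where
  "squarefree_expo a \<longleftrightarrow> (\<forall>v. Poly_Mapping.lookup a v \<in> {0, 1})"

text \<open>Membership of $a - b \in \mathbb{Z}^n$ in $\mathbb{N}^n$; subtraction of exponents is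
  truncated, so \<open>a - b\<close> is the true difference only under this condition.\<close>
definition diff_in_Nn :: "'n expo \<Rightarrow> 'n expo \<Rightarrow> bool" where
  "diff_in_Nn a b \<longleftrightarrow> (\<forall>v. Poly_Mapping.lookup b v \<le> Poly_Mapping.lookup a v)"

definition simplicial_complex :: "'n set set \<Rightarrow> bool" where
  "simplicial_complex \<Delta> \<longleftrightarrow> (\<forall>\<sigma> \<in> \<Delta>. \<forall>\<tau>. \<tau> \<subseteq> \<sigma> \<longrightarrow> \<tau> \<in> \<Delta>)"


definition monomial_mat ::
    "nat \<Rightarrow> nat \<Rightarrow> (nat \<Rightarrow> nat \<Rightarrow> 'k::field) \<Rightarrow> (nat \<Rightarrow> nat \<Rightarrow> 'n expo) \<Rightarrow> ('n, 'k) mpol mat" where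
  "monomial_mat s l c \<alpha> = mat s l (\<lambda>(i, j). Poly_Mapping.single (\<alpha> i j) (c i j))"

definition multigraded_mat :: "('n, 'k::field) mpol mat \<Rightarrow> bool" where
  "multigraded_mat A \<longleftrightarrow>
    (\<forall>I J. I \<subseteq> {..<dim_row A} \<longrightarrow> J \<subseteq> {..<dim_col A} \<longrightarrow> card I = card J \<longrightarrow>
      (\<exists>a c. det (submatrix A I J) = Poly_Mapping.single a c))"

text \<open>The equations are $\gamma_j - \beta_i = \alpha_{ij}$, rearranged because exponents are natural
  numbers. Only solutions in $\mathbb{N}^n$ are represented, which include all squarefree ones.\<close>
definition solves_E ::
    "nat \<Rightarrow> nat \<Rightarrow> (nat \<Rightarrow> nat \<Rightarrow> 'k::field) \<Rightarrow> (nat \<Rightarrow> nat \<Rightarrow> 'n expo) \<Rightarrow>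
      (nat \<Rightarrow> 'n expo) \<Rightarrow> (nat \<Rightarrow> 'n expo) \<Rightarrow> bool" where
  "solves_E s l c \<alpha> \<gamma> \<beta> \<longleftrightarrow> (\<forall>i<s. \<forall>j<l. c i j \<noteq> 0 \<longrightarrow> \<gamma> j = \<alpha> i j + \<beta> i)"

definition squarefree_solution ::
    "nat \<Rightarrow> nat \<Rightarrow> (nat \<Rightarrow> nat \<Rightarrow> 'k::field) \<Rightarrow> (nat \<Rightarrow> nat \<Rightarrow> 'n expo) \<Rightarrow>
      (nat \<Rightarrow> 'n expo) \<Rightarrow> (nat \<Rightarrow> 'n expo) \<Rightarrow> bool" where
  "squarefree_solution s l c \<alpha> \<gamma> \<beta> \<longleftrightarrow> solves_E s l c \<alpha> \<gamma> \<beta> \<and>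
    (\<forall>j<l. squarefree_expo (\<gamma> j)) \<and> (\<forall>i<s. squarefree_expo (\<beta> i))"

definition squarefree_mat ::
    "nat \<Rightarrow> nat \<Rightarrow> (nat \<Rightarrow> nat \<Rightarrow> 'k::field) \<Rightarrow> (nat \<Rightarrow> nat \<Rightarrow> 'n expo) \<Rightarrow> bool" where
  "squarefree_mat s l c \<alpha> \<longleftrightarrow> (\<exists>\<gamma> \<beta>. squarefree_solution s l c \<alpha> \<gamma> \<beta>)"


text \<open>A module record carries the multiplicative fields of a ring record; they are irrelevant, as
  in \<^const>\<open>module_vec\<close>.\<close>
definition quotient_module :: "('a, 'b, 'm) module_scheme \<Rightarrow> 'b set \<Rightarrow> ('a, 'b set) module" where
  "quotient_module M N = \<lparr>
    carrier = a_rcosets\<^bsub>M\<^esub> N,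
    mult = undefined,
    one = undefined,
    zero = N,
    add = set_add M,
    smult = (\<lambda>r X. \<Union>x\<in>X. N +>\<^bsub>M\<^esub> (r \<odot>\<^bsub>M\<^esub> x))\<rparr>"

definition restrict_scalars :: "('c \<Rightarrow> 'a) \<Rightarrow> ('a, 'b, 'm) module_scheme \<Rightarrow> ('c, 'b) module" where
  "restrict_scalars h M = \<lparr>
    carrier = carrier M,
    mult = mult M,
    one = one M,
    zero = zero M,
    add = add M,
    smult = (\<lambda>r. smult M (h r))\<rparr>"

text \<open>The map \<open>(*\<^sub>v) A\<close> from \<open>R\<^sup>l\<close> to \<open>R\<^sup>s\<close> is $\phi_T$: it sends the basis vector $w_j$ to the
  \<open>j\<close>-th column of \<open>A\<close>. As an ungraded map it does not depend on \<open>T\<close>, which only determines the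
  degrees of the basis vectors.\<close>
definition image_mat :: "'a::comm_ring_1 mat \<Rightarrow> 'a vec set" where
  "image_mat A = (\<lambda>w. A *\<^sub>v w) ` carrier_vec (dim_col A)"

definition coker_mat :: "'a::comm_ring_1 mat \<Rightarrow> ('a, 'a vec set) module" where
  "coker_mat A = quotient_module (module_vec TYPE('a) (dim_row A)) (image_mat A)"

definition coker_class :: "'a::comm_ring_1 mat \<Rightarrow> 'a vec \<Rightarrow> 'a vec set" where
  "coker_class A g = image_mat A +>\<^bsub>module_vec TYPE('a) (dim_row A)\<^esub> g"

definition coker_vs :: "('n, 'k::field) mpol mat \<Rightarrow> ('k, ('n, 'k) mpol vec set) module" where
  "coker_vs A = restrict_scalars (Poly_Mapping.single 0) (coker_mat A)"

text \<open>The class of $x^{a} v_i$ in the cokernel.\<close>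
definition mono_class :: "('n, 'k::field) mpol mat \<Rightarrow> 'n expo \<Rightarrow> nat \<Rightarrow> ('n, 'k) mpol vec set" where
  "mono_class A a i = coker_class A (Poly_Mapping.single a 1 \<cdot>\<^sub>v unit_vec (dim_row A) i)"


text \<open>The quotient by a submodule is a module, and the cokernel is a vector space over \<open>'k\<close>, so that
  \<open>vectorspace.basis class_ring (coker_vs A)\<close> has its intended meaning.\<close>

lemma (in Module.module) quotient_module_is_module:
  assumes "Module.submodule N R M"
  shows "Module.module R (quotient_module M N)"
proof -
  interpret N: Module.submodule N R M by fact
  interpret A: abelian_subgroup N M
    by (rule abelian_subgroupI3[OF _ M.abelian_group_axioms])
      (simp add: additive_subgroup_def N.subgroup_axioms)
  have rep: "\<exists>x\<in>carrier M. X = N +>\<^bsub>M\<^esub> x" if "X \<in> carrier (quotient_module M N)" for X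
    using that by (auto simp: quotient_module_def A_RCOSETS_def')
  have car: "N +>\<^bsub>M\<^esub> x \<in> carrier (quotient_module M N)" if "x \<in> carrier M" for x
    using that by (auto simp: quotient_module_def A_RCOSETS_def')
  have add: "(N +>\<^bsub>M\<^esub> x) \<oplus>\<^bsub>quotient_module M N\<^esub> (N +>\<^bsub>M\<^esub> y) = N +>\<^bsub>M\<^esub> (x \<oplus>\<^bsub>M\<^esub> y)"
    if "x \<in> carrier M" "y \<in> carrier M" for x y
    using that by (simp add: quotient_module_def A.a_rcos_sum)
  have eqI: "N +>\<^bsub>M\<^esub> y = N +>\<^bsub>M\<^esub> x" if "x \<in> carrier M" "y \<in> N +>\<^bsub>M\<^esub> x" for x y
    using A.a_repr_independence' that by blast
  have sm: "r \<odot>\<^bsub>quotient_module M N\<^esub> (N +>\<^bsub>M\<^esub> x) = N +>\<^bsub>M\<^esub> (r \<odot>\<^bsub>M\<^esub> x)"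
    if r: "r \<in> carrier R" and x: "x \<in> carrier M" for r x
  proof -
    have "N +>\<^bsub>M\<^esub> (r \<odot>\<^bsub>M\<^esub> y) = N +>\<^bsub>M\<^esub> (r \<odot>\<^bsub>M\<^esub> x)" if "y \<in> N +>\<^bsub>M\<^esub> x" for y
    proof (rule eqI)
      from that obtain h where h: "h \<in> N" "y = h \<oplus>\<^bsub>M\<^esub> x" by (auto simp: a_r_coset_def')
      have "r \<odot>\<^bsub>M\<^esub> y = r \<odot>\<^bsub>M\<^esub> h \<oplus>\<^bsub>M\<^esub> r \<odot>\<^bsub>M\<^esub> x"
        using h r x N.subset by (auto simp: smult_r_distr)
      then show "r \<odot>\<^bsub>M\<^esub> y \<in> N +>\<^bsub>M\<^esub> (r \<odot>\<^bsub>M\<^esub> x)"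
        using h r by (auto simp: a_r_coset_def')
    qed (use r x in auto)
    moreover have "N +>\<^bsub>M\<^esub> x \<noteq> {}" using A.a_rcos_self[OF x] by blast
    ultimately have "(\<Union>y\<in>N +>\<^bsub>M\<^esub> x. N +>\<^bsub>M\<^esub> (r \<odot>\<^bsub>M\<^esub> y)) = N +>\<^bsub>M\<^esub> (r \<odot>\<^bsub>M\<^esub> x)"
      by (intro SUP_eq_const)
    then show ?thesis by (simp only: quotient_module_def module.simps)
  qed
  have ab: "abelian_group (quotient_module M N)"
  proof (rule abelian_groupI)
    have z: "\<zero>\<^bsub>quotient_module M N\<^esub> = N +>\<^bsub>M\<^esub> \<zero>\<^bsub>M\<^esub>"
      using N.subset by (auto simp: quotient_module_def a_coset_add_zero)
    show "\<zero>\<^bsub>quotient_module M N\<^esub> \<in> carrier (quotient_module M N)" by (simp add: z car)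
    fix x y w assume "x \<in> carrier (quotient_module M N)" "y \<in> carrier (quotient_module M N)" "w \<in> carrier (quotient_module M N)"
    then obtain x' y' w' where *: "x' \<in> carrier M" "y' \<in> carrier M" "w' \<in> carrier M"
      "x = N +>\<^bsub>M\<^esub> x'" "y = N +>\<^bsub>M\<^esub> y'" "w = N +>\<^bsub>M\<^esub> w'" using rep by metis
    from * show "x \<oplus>\<^bsub>quotient_module M N\<^esub> y \<in> carrier (quotient_module M N)" by (simp add: add car)
    from * show "x \<oplus>\<^bsub>quotient_module M N\<^esub> y = y \<oplus>\<^bsub>quotient_module M N\<^esub> x" by (simp add: add M.a_comm)
    from * show "x \<oplus>\<^bsub>quotient_module M N\<^esub> y \<oplus>\<^bsub>quotient_module M N\<^esub> w = x \<oplus>\<^bsub>quotient_module M N\<^esub> (y \<oplus>\<^bsub>quotient_module M N\<^esub> w)"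
      by (simp add: add M.a_assoc)
    from * show "\<zero>\<^bsub>quotient_module M N\<^esub> \<oplus>\<^bsub>quotient_module M N\<^esub> x = x" by (simp add: add z)
    from * have "(N +>\<^bsub>M\<^esub> (\<ominus>\<^bsub>M\<^esub> x')) \<oplus>\<^bsub>quotient_module M N\<^esub> x = \<zero>\<^bsub>quotient_module M N\<^esub>"
      by (simp add: add z M.l_neg)
    then show "\<exists>y\<in>carrier (quotient_module M N). y \<oplus>\<^bsub>quotient_module M N\<^esub> x = \<zero>\<^bsub>quotient_module M N\<^esub>"
      using * car by blast
  qed
  show ?thesis
  proof (rule moduleI)
    show "cring R" by unfold_locales
    show "abelian_group (quotient_module M N)" by (rule ab)
    fix a b x y
    assume a: "a \<in> carrier R" and x: "x \<in> carrier (quotient_module M N)"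
    then obtain x' where *: "x' \<in> carrier M" "x = N +>\<^bsub>M\<^esub> x'" using rep by metis
    from * a show "a \<odot>\<^bsub>quotient_module M N\<^esub> x \<in> carrier (quotient_module M N)" by (simp add: sm car)
    { assume y: "y \<in> carrier (quotient_module M N)"
      then obtain y' where y: "y' \<in> carrier M" "y = N +>\<^bsub>M\<^esub> y'" using rep by metis
      from * a y show "a \<odot>\<^bsub>quotient_module M N\<^esub> (x \<oplus>\<^bsub>quotient_module M N\<^esub> y)
         = a \<odot>\<^bsub>quotient_module M N\<^esub> x \<oplus>\<^bsub>quotient_module M N\<^esub> a \<odot>\<^bsub>quotient_module M N\<^esub> y"
        by (simp add: sm add smult_r_distr) }
    { assume b: "b \<in> carrier R"
      from * a b show "(a \<oplus>\<^bsub>R\<^esub> b) \<odot>\<^bsub>quotient_module M N\<^esub> x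
         = a \<odot>\<^bsub>quotient_module M N\<^esub> x \<oplus>\<^bsub>quotient_module M N\<^esub> b \<odot>\<^bsub>quotient_module M N\<^esub> x"
        by (simp add: sm add smult_l_distr)
      from * a b show "(a \<otimes>\<^bsub>R\<^esub> b) \<odot>\<^bsub>quotient_module M N\<^esub> x
         = a \<odot>\<^bsub>quotient_module M N\<^esub> (b \<odot>\<^bsub>quotient_module M N\<^esub> x)"
        by (simp add: sm smult_assoc1) }
  next
    fix x assume "x \<in> carrier (quotient_module M N)"
    then obtain x' where *: "x' \<in> carrier M" "x = N +>\<^bsub>M\<^esub> x'" using rep by metis
    then show "\<one>\<^bsub>R\<^esub> \<odot>\<^bsub>quotient_module M N\<^esub> x = x" by (simp add: sm)
  qed
qed

lemma submodule_image_mat: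
  fixes A :: "'a::comm_ring_1 mat"
  shows "Module.submodule (image_mat A) class_ring (module_vec TYPE('a) (dim_row A))"
proof -
  interpret vec_module "TYPE('a)" "dim_row A" .
  have A: "A \<in> carrier_mat (dim_row A) (dim_col A)" by simp
  show ?thesis
  proof (rule module.submoduleI[OF module_axioms])
    show "image_mat A \<subseteq> carrier V" by (auto simp: image_mat_def module_vec_simps intro: mult_mat_vec_carrier[OF A])
    have "A *\<^sub>v 0\<^sub>v (dim_col A) = 0\<^sub>v (dim_row A)" by auto
    then show "\<zero>\<^bsub>V\<^esub> \<in> image_mat A"
      by (auto simp: image_mat_def module_vec_simps intro!: image_eqI[of _ _ "0\<^sub>v (dim_col A)"])
    fix x y assume x: "x \<in> image_mat A"
    then obtain u where u: "u \<in> carrier_vec (dim_col A)" "x = A *\<^sub>v u" by (auto simp: image_mat_def)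
    have Au: "A *\<^sub>v u \<in> carrier_vec (dim_row A)" by (rule mult_mat_vec_carrier[OF A u(1)])
    have s: "a \<odot>\<^bsub>V\<^esub> x \<in> image_mat A" for a
    proof -
      have "A *\<^sub>v (a \<cdot>\<^sub>v u) = a \<cdot>\<^sub>v (A *\<^sub>v u)"
        using u by (intro eq_vecI) (auto simp: scalar_prod_def sum_distrib_left ac_simps)
      with u show ?thesis by (auto simp: image_mat_def module_vec_simps intro!: image_eqI[of _ _ "a \<cdot>\<^sub>v u"])
    qed
    then show "a \<odot>\<^bsub>V\<^esub> x \<in> image_mat A" for a .
    have "x \<in> carrier V" using u Au by (simp add: module_vec_simps)
    then have "\<ominus>\<^bsub>V\<^esub> x = (- 1) \<odot>\<^bsub>V\<^esub> x"
      by (intro M.minus_equality) (auto simp: module_vec_simps)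
    then show "\<ominus>\<^bsub>V\<^esub> x \<in> image_mat A" using s by simp
    assume "y \<in> image_mat A"
    then obtain w where w: "w \<in> carrier_vec (dim_col A)" "y = A *\<^sub>v w" by (auto simp: image_mat_def)
    then show "x \<oplus>\<^bsub>V\<^esub> y \<in> image_mat A"
      using u mult_add_distrib_mat_vec[OF A u(1) w(1), symmetric] by (auto simp: image_mat_def module_vec_simps)
  qed
qed

lemma module_coker_mat: "Module.module class_ring (coker_mat (A :: 'a::comm_ring_1 mat))"
proof -
  interpret vec_module "TYPE('a)" "dim_row A" .
  show ?thesis unfolding coker_mat_def by (rule quotient_module_is_module[OF submodule_image_mat])
qed

lemma vectorspace_coker_vs: "vectorspace class_ring (coker_vs (A :: ('n, 'k::field) mpol mat))"
proof -
  interpret C: Module.module "class_ring :: ('n, 'k) mpol ring" "coker_mat A" by (rule module_coker_mat)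
  have ab: "abelian_group (coker_vs A)"
    by (rule abelian_groupI)
      (auto simp: coker_vs_def restrict_scalars_def C.M.a_ac intro: C.add.l_inv_ex)
  have "Module.module class_ring (coker_vs A)"
  proof (rule moduleI[OF class_cring.cring_axioms ab], goal_cases)
    case (4 a b x)
    then have "(Poly_Mapping.single 0 a * Poly_Mapping.single 0 b) \<odot>\<^bsub>coker_mat A\<^esub> x =
      Poly_Mapping.single 0 a \<odot>\<^bsub>coker_mat A\<^esub> (Poly_Mapping.single 0 b \<odot>\<^bsub>coker_mat A\<^esub> x)"
      using C.smult_assoc1[of "Poly_Mapping.single 0 a" "Poly_Mapping.single 0 b" x]
      by (simp add: coker_vs_def restrict_scalars_def)
    then show ?case by (simp add: coker_vs_def restrict_scalars_def mult_single)
  qed (auto simp: coker_vs_def restrict_scalars_def single_add C.smult_l_distr[simplified]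
      C.smult_r_distr C.smult_one[simplified])
  then show ?thesis by (simp add: vectorspace_def class_field.field_axioms)
qed

end

theory Submission
  imports Defs
begin

text \<open>In degree \<open>d\<close>, the cokernel is \<open>k\<^bsup>S\<^esup>\<close> with \<open>S = {i. \<beta> i \<le> d}\<close>, modulo the span \<open>W\<close> of the
  columns \<open>j\<close> of the coefficient matrix with \<open>\<gamma> j \<le> d\<close>. As the \<open>\<gamma> j\<close> are squarefree, \<open>W\<close> depends
  only on \<open>supp(d)\<close> and grows with it. The unit vectors at the indices that are not the last
  nonzero position of a vector of \<open>W\<close> form a basis of the quotient, so \<open>\<Delta> i\<close> consists of the
  \<open>\<sigma>\<close> for which \<open>i\<close> is no such position for \<open>supp(d) = \<sigma> \<union> supp(\<beta> i)\<close>. A vector of \<open>W\<close> with last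
  nonzero position \<open>i\<close> rewrites the generator \<open>i\<close> in terms of smaller ones, which gives (2).\<close>

section \<open>Exponent vectors, divisibility and coefficients of monomial products\<close>

lemma diff_in_Nn_add_diff: "diff_in_Nn a b \<Longrightarrow> b + (a - b) = a"
  by (rule poly_mapping_eqI) (simp add: diff_in_Nn_def lookup_add lookup_minus)

lemma diff_in_Nn_add: "diff_in_Nn (a + b) b" "diff_in_Nn (b + a) b"
  by (simp_all add: diff_in_Nn_def lookup_add)

lemma diff_in_Nn_trans: "diff_in_Nn a b \<Longrightarrow> diff_in_Nn b c \<Longrightarrow> diff_in_Nn a c"
  unfolding diff_in_Nn_def using le_trans by blast

lemma keys_add_expo: "Poly_Mapping.keys (a + b :: 'n expo) = Poly_Mapping.keys a \<union> Poly_Mapping.keys b"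
  by (auto simp: in_keys_iff lookup_add)

text \<open>Each entry of \<open>b\<close> is at most 1, so being below \<open>d\<close> only
  requires \<open>d\<close> to be nonzero wherever \<open>b\<close> is. Through this lemma
  squarefreeness reduces degrees to supports.\<close>

lemma squarefree_diff_in_Nn_iff:
  assumes "squarefree_expo b"
  shows "diff_in_Nn d b \<longleftrightarrow> Poly_Mapping.keys b \<subseteq> Poly_Mapping.keys d"
proof
  assume "diff_in_Nn d b"
  then show "Poly_Mapping.keys b \<subseteq> Poly_Mapping.keys d"
    by (metis Un_upper1 diff_in_Nn_add_diff keys_add_expo)
next
  assume sub: "Poly_Mapping.keys b \<subseteq> Poly_Mapping.keys d"
  show "diff_in_Nn d b"
    unfolding diff_in_Nn_def
  proof
    fix v
    have "Poly_Mapping.lookup b v = 0 \<or> Poly_Mapping.lookup b v = 1" using assms by (auto simp: squarefree_expo_def)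
    moreover have "Poly_Mapping.lookup b v \<noteq> 0 \<Longrightarrow> Poly_Mapping.lookup d v \<noteq> 0" using sub in_keys_iff by (metis subsetD)
    ultimately show "Poly_Mapping.lookup b v \<le> Poly_Mapping.lookup d v" by auto
  qed
qed

lemma lookup_single_mult:
  fixes p :: "('n, 'k::field) mpol"
  shows "Poly_Mapping.lookup (Poly_Mapping.single a k * p) e = (if diff_in_Nn e a then k * Poly_Mapping.lookup p (e - a) else 0)"
proof -
  have "Poly_Mapping.lookup (Poly_Mapping.single a k * p) e = k * (\<Sum>q. Poly_Mapping.lookup p q when e = a + q)"
    by (simp add: lookup_mult lookup_single when_mult)
  \<comment> \<open>At most one \<open>q\<close> contributes, namely \<open>e - a\<close>; the guard
    excludes the case in which this truncated difference is not the true one.\<close>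
  also have "(\<Sum>q. Poly_Mapping.lookup p q when e = a + q) = (\<Sum>q. Poly_Mapping.lookup p q when diff_in_Nn e a \<and> q = e - a)"
    by (rule Sum_any.cong, rule when_cong) (auto simp: diff_in_Nn_add diff_in_Nn_add_diff)
  finally show ?thesis by simp
qed

lemma single_sum: "Poly_Mapping.single a (\<Sum>x\<in>X. f x) = (\<Sum>x\<in>X. Poly_Mapping.single a (f x))"
  by (induction X rule: infinite_finite_induct) (simp_all add: single_add)

lemma sum_single_keys: "(\<Sum>b\<in>Poly_Mapping.keys p. Poly_Mapping.single b (Poly_Mapping.lookup p b)) = p"
  by (rule poly_mapping_eqI) (auto simp: lookup_sum lookup_single when_def in_keys_iff)

section \<open>Cosets of the image and finite sums of monomial classes\<close>

lemma image_mat_carrier: "g \<in> image_mat A \<Longrightarrow> g \<in> carrier_vec (dim_row A)"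
  by (auto simp: image_mat_def intro!: mult_mat_vec_carrier[of _ _ "dim_col A"])

lemma image_mat_closed:
  fixes A :: "'a::comm_ring_1 mat"
  shows zero_in_image_mat: "0\<^sub>v (dim_row A) \<in> image_mat A"
    and add_in_image_mat: "g \<in> image_mat A \<Longrightarrow> h \<in> image_mat A \<Longrightarrow> g + h \<in> image_mat A"
    and smult_in_image_mat: "g \<in> image_mat A \<Longrightarrow> r \<cdot>\<^sub>v g \<in> image_mat A"
proof -
  interpret Module.submodule "image_mat A" class_ring "module_vec TYPE('a) (dim_row A)"
    by (rule submodule_image_mat)
  show "0\<^sub>v (dim_row A) \<in> image_mat A"
    using subgroup.one_closed[OF subgroup_axioms] by (simp add: module_vec_simps)
  show "g \<in> image_mat A \<Longrightarrow> h \<in> image_mat A \<Longrightarrow> g + h \<in> image_mat A"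
    using m_closed by (simp add: module_vec_simps)
  show "g \<in> image_mat A \<Longrightarrow> r \<cdot>\<^sub>v g \<in> image_mat A"
    using smult_closed by (simp add: module_vec_simps)
qed

lemma coker_class_eq: "coker_class A g = (\<lambda>x. x + g) ` image_mat A"
  by (auto simp: coker_class_def a_r_coset_def' module_vec_simps)

lemma coker_class_eq_iff:
  fixes A :: "'a::comm_ring_1 mat"
  assumes g: "g \<in> carrier_vec (dim_row A)" and h: "h \<in> carrier_vec (dim_row A)"
  shows "coker_class A g = coker_class A h \<longleftrightarrow> g - h \<in> image_mat A"
proof
  assume "coker_class A g = coker_class A h"
  moreover have "g \<in> coker_class A g"
    using zero_in_image_mat[of A] g by (force simp: coker_class_eq)
  ultimately obtain x where x: "x \<in> image_mat A" "g = x + h" by (auto simp: coker_class_eq)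
  then have "g - h = x" using image_mat_carrier[OF x(1)] h by auto
  with x show "g - h \<in> image_mat A" by simp
next
  assume gh: "g - h \<in> image_mat A"
  have "h - g = - 1 \<cdot>\<^sub>v (g - h)" using g h by (intro eq_vecI) auto
  then have hg: "h - g \<in> image_mat A" using smult_in_image_mat[OF gh] by metis
  have *: "coker_class A g \<subseteq> coker_class A h"
    if "g - h \<in> image_mat A" "g \<in> carrier_vec (dim_row A)" "h \<in> carrier_vec (dim_row A)" for g h
  proof
    fix y assume "y \<in> coker_class A g"
    then obtain x where x: "x \<in> image_mat A" "y = x + g" by (auto simp: coker_class_eq)
    then have "y = (x + (g - h)) + h" using that image_mat_carrier[OF x(1)] by (intro eq_vecI) auto
    then show "y \<in> coker_class A h" using add_in_image_mat[OF x(1) that(1)] by (auto simp: coker_class_eq)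
  qed
  show "coker_class A g = coker_class A h" using *[OF gh g h] *[OF hg h g] by auto
qed

lemma carrier_coker_vs: "carrier (coker_vs A) = coker_class A ` carrier_vec (dim_row A)"
  by (auto simp: coker_vs_def restrict_scalars_def coker_mat_def quotient_module_def
      A_RCOSETS_def' coker_class_def module_vec_simps)

lemma zero_coker_vs:
  fixes A :: "('n, 'k::field) mpol mat"
  shows "\<zero>\<^bsub>coker_vs A\<^esub> = coker_class A (0\<^sub>v (dim_row A))"
proof -
  have "(\<lambda>x. x + 0\<^sub>v (dim_row A)) ` image_mat A = (\<lambda>x. x) ` image_mat A"
    by (rule image_cong) (auto dest: image_mat_carrier)
  then show ?thesis
    by (simp add: coker_vs_def restrict_scalars_def coker_mat_def quotient_module_def coker_class_eq)
qed

lemma add_coker_class: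
  fixes A :: "('n, 'k::field) mpol mat"
  assumes g: "g \<in> carrier_vec (dim_row A)" and h: "h \<in> carrier_vec (dim_row A)"
  shows "coker_class A g \<oplus>\<^bsub>coker_vs A\<^esub> coker_class A h = coker_class A (g + h)"
proof -
  let ?M = "module_vec TYPE(('n, 'k) mpol) (dim_row A)"
  interpret vec_module "TYPE(('n, 'k) mpol)" "dim_row A" .
  interpret N: Module.submodule "image_mat A" class_ring ?M by (rule submodule_image_mat)
  interpret abelian_subgroup "image_mat A" ?M
    by (rule abelian_subgroupI3[OF _ M.abelian_group_axioms])
      (simp add: additive_subgroup_def N.subgroup_axioms)
  show ?thesis using a_rcos_sum[of g h] g h
    by (simp add: coker_vs_def restrict_scalars_def coker_mat_def quotient_module_def
        coker_class_def module_vec_simps)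
qed

lemma smult_coker_class:
  fixes A :: "('n, 'k::field) mpol mat"
  assumes g: "g \<in> carrier_vec (dim_row A)"
  shows "r \<odot>\<^bsub>coker_vs A\<^esub> coker_class A g = coker_class A (Poly_Mapping.single 0 r \<cdot>\<^sub>v g)"
proof -
  let ?p = "Poly_Mapping.single 0 r"
  have *: "coker_class A (?p \<cdot>\<^sub>v y) = coker_class A (?p \<cdot>\<^sub>v g)" if y: "y \<in> coker_class A g" for y
  proof -
    from y obtain x where x: "x \<in> image_mat A" "y = x + g" by (auto simp: coker_class_eq)
    then have xc: "x \<in> carrier_vec (dim_row A)" by (simp add: image_mat_carrier)
    have "?p \<cdot>\<^sub>v y - ?p \<cdot>\<^sub>v g = ?p \<cdot>\<^sub>v x"
      using g xc by (auto simp: x(2) smult_add_distrib_vec)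
    then show ?thesis
      using g xc x smult_in_image_mat[of x A ?p] by (subst coker_class_eq_iff) auto
  qed
  \<comment> \<open>Scalar multiplication in the quotient is a union over all representatives. They
    all yield the same coset, and a nonempty union of equal sets is that set.\<close>
  have "coker_class A g \<noteq> {}" using zero_in_image_mat[of A] by (auto simp: coker_class_eq)
  then have "(\<Union>y\<in>coker_class A g. coker_class A (?p \<cdot>\<^sub>v y)) = coker_class A (?p \<cdot>\<^sub>v g)"
    using * by (intro SUP_eq_const)
  then show ?thesis
    by (simp add: coker_vs_def restrict_scalars_def coker_mat_def quotient_module_def
        coker_class_def[symmetric] module_vec_simps)
qed

text \<open>Turns a linear combination in the cokernel into the class of one explicit vector, whose
  entry \<open>k\<close> collects the terms at row \<open>k\<close>. The index set is left abstract
  so that it can consist of row-exponent pairs or of rows alone.\<close>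

lemma finsum_mono_class:
  fixes A :: "('n, 'k::field) mpol mat"
  assumes "finite F" "\<And>x. x \<in> F \<Longrightarrow> i x < dim_row A"
  shows "finsum (coker_vs A) (\<lambda>x. r x \<odot>\<^bsub>coker_vs A\<^esub> mono_class A (b x) (i x)) F =
    coker_class A (vec (dim_row A) (\<lambda>k. \<Sum>x\<in>F. if i x = k then Poly_Mapping.single (b x) (r x) else 0))"
proof -
  interpret V: vectorspace class_ring "coker_vs A" by (rule vectorspace_coker_vs)
  let ?v = "\<lambda>x. vec (dim_row A) (\<lambda>k. if i x = k then Poly_Mapping.single (b x) (r x) else 0)"
  have summand: "r x \<odot>\<^bsub>coker_vs A\<^esub> mono_class A (b x) (i x) = coker_class A (?v x)" if "i x < dim_row A" for x
  proof -
    have "Poly_Mapping.single 0 (r x) \<cdot>\<^sub>v (Poly_Mapping.single (b x) 1 \<cdot>\<^sub>v unit_vec (dim_row A) (i x)) = ?v x"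
      by (rule eq_vecI) (auto simp: unit_vec_def mult_single)
    then show ?thesis unfolding mono_class_def by (subst smult_coker_class) auto
  qed
  have car: "r x \<odot>\<^bsub>coker_vs A\<^esub> mono_class A (b x) (i x) \<in> carrier (coker_vs A)" if "i x < dim_row A" for x
    by (auto simp: summand[OF that] carrier_coker_vs)
  show ?thesis using assms
  proof (induction F rule: finite_induct)
    case empty
    have "0\<^sub>v (dim_row A) = vec (dim_row A) (\<lambda>k. 0 :: ('n, 'k) mpol)" by (simp add: zero_vec_def)
    then show ?case by (simp add: zero_coker_vs)
  next
    case (insert y F)
    have "finsum (coker_vs A) (\<lambda>x. r x \<odot>\<^bsub>coker_vs A\<^esub> mono_class A (b x) (i x)) (insert y F) =
        coker_class A (?v y) \<oplus>\<^bsub>coker_vs A\<^esub>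
        coker_class A (vec (dim_row A) (\<lambda>k. \<Sum>x\<in>F. if i x = k then Poly_Mapping.single (b x) (r x) else 0))"
      using insert car summand by (subst V.M.finsum_insert) auto
    also have "\<dots> = coker_class A (?v y + vec (dim_row A) (\<lambda>k. \<Sum>x\<in>F. if i x = k then Poly_Mapping.single (b x) (r x) else 0))"
      by (rule add_coker_class) auto
    also have "?v y + vec (dim_row A) (\<lambda>k. \<Sum>x\<in>F. if i x = k then Poly_Mapping.single (b x) (r x) else 0) =
        vec (dim_row A) (\<lambda>k. \<Sum>x\<in>insert y F. if i x = k then Poly_Mapping.single (b x) (r x) else 0)"
      using insert by (intro eq_vecI) auto
    finally show ?case .
  qed
qed

text \<open>A vector is the finite sum of its monomial terms; hence the classes of all x^b v_i span
  the cokernel over the field.\<close>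

lemma coker_class_as_finsum:
  fixes A :: "('n, 'k::field) mpol mat"
  assumes "g \<in> carrier_vec (dim_row A)"
  shows "coker_class A g = finsum (coker_vs A)
    (\<lambda>(i, b). Poly_Mapping.lookup (g $ i) b \<odot>\<^bsub>coker_vs A\<^esub> mono_class A b i)
    (Sigma {..<dim_row A} (\<lambda>i. Poly_Mapping.keys (g $ i)))"
proof -
  let ?F = "Sigma {..<dim_row A} (\<lambda>i. Poly_Mapping.keys (g $ i))"
  have "vec (dim_row A) (\<lambda>k. \<Sum>x\<in>?F. if fst x = k then
      Poly_Mapping.single (snd x) (Poly_Mapping.lookup (g $ fst x) (snd x)) else 0) = g"
  proof (rule eq_vecI)
    fix k assume "k < dim_vec g"
    then have k: "k < dim_row A" using assms by simp
    have "(\<Sum>x\<in>?F. if fst x = k then Poly_Mapping.single (snd x) (Poly_Mapping.lookup (g $ fst x) (snd x)) else 0) =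
      (\<Sum>i<dim_row A. \<Sum>b\<in>Poly_Mapping.keys (g $ i). if i = k then Poly_Mapping.single b (Poly_Mapping.lookup (g $ i) b) else 0)"
      by (subst sum.Sigma) (auto simp: case_prod_unfold)
    also have "\<dots> = (\<Sum>i<dim_row A. if i = k then g $ i else 0)"
      by (intro sum.cong) (auto simp: sum_single_keys)
    also have "\<dots> = g $ k" using k by simp
    finally show "vec (dim_row A) (\<lambda>k. \<Sum>x\<in>?F. if fst x = k then
      Poly_Mapping.single (snd x) (Poly_Mapping.lookup (g $ fst x) (snd x)) else 0) $ k = g $ k" using k by simp
  qed (use assms in simp)
  then show ?thesis
    using finsum_mono_class[of ?F fst A "\<lambda>x. Poly_Mapping.lookup (g $ fst x) (snd x)" snd]
    by (auto simp: case_prod_unfold)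
qed

lemma submodule_finsum_closed:
  assumes "LinearCombinations.submodule R N M" "finite F" "\<And>x. x \<in> F \<Longrightarrow> g x \<in> N"
  shows "finsum M g F \<in> N"
proof -
  interpret LinearCombinations.submodule R N M by fact
  interpret Module.module R M by (rule module)
  show ?thesis using assms(2,3)
  proof (induction F rule: finite_induct)
    case (insert x F)
    then have "g \<in> F \<rightarrow> carrier M" "g x \<in> carrier M" using subset by auto
    with insert show ?case by (simp add: finsum_insert)
  qed simp
qed

section \<open>Relations in a fixed degree and their leading positions\<close>

locale squarefree_presentation =
  fixes s l :: nat
    and c :: "nat \<Rightarrow> nat \<Rightarrow> 'k::field"
    and \<alpha> :: "nat \<Rightarrow> nat \<Rightarrow> 'n expo"
    and \<gamma> \<beta> :: "nat \<Rightarrow> 'n expo"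
  assumes solution: "squarefree_solution s l c \<alpha> \<gamma> \<beta>"
begin

abbreviation A :: "('n, 'k) mpol mat" where
  "A \<equiv> monomial_mat s l c \<alpha>"

text \<open>For \<open>\<sigma> = supp(d)\<close> this is the degree \<open>d\<close> part of the image of \<open>\<phi>\<close>, where \<open>u\<close> stands for the
  element with entries \<open>u i * x^(d - \<beta> i)\<close>. Only \<open>\<sigma>\<close> matters because \<open>\<gamma> j\<close> is squarefree.\<close>
definition relations :: "'n set \<Rightarrow> (nat \<Rightarrow> 'k) set" where
  "relations \<sigma> = {u. \<exists>x. (\<forall>j<l. x j \<noteq> 0 \<longrightarrow> Poly_Mapping.keys (\<gamma> j) \<subseteq> \<sigma>) \<and>
     u = (\<lambda>i. if i < s then \<Sum>j<l. c i j * x j else 0)}"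

text \<open>The last nonzero entry is normalised to 1, which loses nothing because relations can be
  rescaled.\<close>

definition leading :: "'n set \<Rightarrow> nat set" where
  "leading \<sigma> = {i. \<exists>u\<in>relations \<sigma>. u i = 1 \<and> (\<forall>j>i. u j = 0)}"

definition standard :: "nat \<Rightarrow> 'n set set" where
  "standard i = {\<sigma>. i \<notin> leading (\<sigma> \<union> Poly_Mapping.keys (\<beta> i))}"

lemma relationsI:
  assumes "\<And>j. j < l \<Longrightarrow> x j \<noteq> 0 \<Longrightarrow> Poly_Mapping.keys (\<gamma> j) \<subseteq> \<sigma>"
    and "\<And>i. u i = (if i < s then \<Sum>j<l. c i j * x j else 0)"
  shows "u \<in> relations \<sigma>"
  unfolding relations_def using assms by (intro CollectI exI[of _ x]) auto

lemma relationsE: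
  assumes "u \<in> relations \<sigma>"
  obtains x where "\<forall>j<l. x j \<noteq> 0 \<longrightarrow> Poly_Mapping.keys (\<gamma> j) \<subseteq> \<sigma>"
    and "\<forall>i. u i = (if i < s then \<Sum>j<l. c i j * x j else 0)"
  using assms unfolding relations_def by auto

lemma relations_zero: "(\<lambda>_. 0) \<in> relations \<sigma>"
  by (rule relationsI[of "\<lambda>_. 0"]) auto

text \<open>Together with \<open>relations_zero\<close> this makes \<open>relations \<sigma>\<close>
  a subspace; rescaling is the case where \<open>u\<close> is zero.\<close>

lemma relations_add_smult:
  assumes "u \<in> relations \<sigma>" "w \<in> relations \<sigma>"
  shows "(\<lambda>i. u i + k * w i) \<in> relations \<sigma>"
proof -
  obtain x where x: "\<forall>j<l. x j \<noteq> 0 \<longrightarrow> Poly_Mapping.keys (\<gamma> j) \<subseteq> \<sigma>"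
    "\<forall>i. u i = (if i < s then \<Sum>j<l. c i j * x j else 0)"
    using assms(1) by (rule relationsE)
  obtain y where y: "\<forall>j<l. y j \<noteq> 0 \<longrightarrow> Poly_Mapping.keys (\<gamma> j) \<subseteq> \<sigma>"
    "\<forall>i. w i = (if i < s then \<Sum>j<l. c i j * y j else 0)"
    using assms(2) by (rule relationsE)
  show ?thesis
  proof (rule relationsI[of "\<lambda>j. x j + k * y j"])
    fix j assume "j < l" "x j + k * y j \<noteq> 0"
    then show "Poly_Mapping.keys (\<gamma> j) \<subseteq> \<sigma>" using x(1)[rule_format, of j] y(1)[rule_format, of j]
      by (cases "x j = 0") simp_all
  next
    fix i
    show "u i + k * w i = (if i < s then \<Sum>j<l. c i j * (x j + k * y j) else 0)"
      by (simp add: x(2) y(2) ring_distribs sum.distrib sum_distrib_left mult.left_commute)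
  qed
qed

lemma relations_mono: "\<sigma> \<subseteq> \<tau> \<Longrightarrow> relations \<sigma> \<subseteq> relations \<tau>"
  unfolding relations_def by blast

lemma leading_mono: "\<sigma> \<subseteq> \<tau> \<Longrightarrow> leading \<sigma> \<subseteq> leading \<tau>"
  using relations_mono unfolding leading_def by blast

text \<open>A smaller support admits fewer relations and so fewer leading positions; a position that
  is not leading stays so when the set shrinks.\<close>

lemma simplicial_complex_standard: "simplicial_complex (standard i)"
  unfolding simplicial_complex_def standard_def
  using leading_mono[OF Un_mono[OF _ order_refl]] by (simp add: subset_iff) metis

lemma solution_eq: "i < s \<Longrightarrow> j < l \<Longrightarrow> c i j \<noteq> 0 \<Longrightarrow> \<gamma> j = \<alpha> i j + \<beta> i"
  using solution by (auto simp: squarefree_solution_def solves_E_def)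

lemma \<gamma>_le_iff: "j < l \<Longrightarrow> diff_in_Nn d (\<gamma> j) \<longleftrightarrow> Poly_Mapping.keys (\<gamma> j) \<subseteq> Poly_Mapping.keys d"
  using solution by (simp add: squarefree_solution_def squarefree_diff_in_Nn_iff)

text \<open>A nonzero entry \<open>i\<close> needs a column \<open>j\<close> with
  \<open>c i j \<noteq> 0\<close> and \<gamma> j \<le> d, and then \<beta> i \<le> \<alpha> i j +
  \<beta> i = \<gamma> j \<le> d. So a relation only involves rows that are present in degree
  \<open>d\<close>.\<close>

lemma relations_support:
  assumes "u \<in> relations (Poly_Mapping.keys d)" "u i \<noteq> 0"
  shows "diff_in_Nn d (\<beta> i)"
proof -
  obtain x where x: "\<forall>j<l. x j \<noteq> 0 \<longrightarrow> Poly_Mapping.keys (\<gamma> j) \<subseteq> Poly_Mapping.keys d"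
    "\<forall>i. u i = (if i < s then \<Sum>j<l. c i j * x j else 0)"
    using assms(1) by (rule relationsE)
  have "i < s" using x(2)[rule_format, of i] assms(2) by (simp split: if_splits)
  then have "(\<Sum>j<l. c i j * x j) \<noteq> 0" using x(2)[rule_format, of i] assms(2) by simp
  then obtain j where "j \<in> {..<l}" "c i j * x j \<noteq> 0" by (rule sum.not_neutral_contains_not_neutral)
  then have "j < l" "Poly_Mapping.keys (\<gamma> j) \<subseteq> Poly_Mapping.keys d" "c i j \<noteq> 0" using x(1) by auto
  then have "diff_in_Nn d (\<gamma> j)" "\<gamma> j = \<alpha> i j + \<beta> i"
    using \<open>i < s\<close> \<gamma>_le_iff solution_eq by blast+
  then show ?thesis using diff_in_Nn_trans diff_in_Nn_add(1) by metis
qed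

text \<open>Supports of exponents add without cancellation, so \<open>d - \<beta> i\<close> and
  \<open>\<beta> i\<close> together have the support of \<open>d\<close>.\<close>

lemma mem_standard_iff:
  assumes "diff_in_Nn d (\<beta> i)"
  shows "Poly_Mapping.keys (d - \<beta> i) \<in> standard i \<longleftrightarrow> i \<notin> leading (Poly_Mapping.keys d)"
proof -
  have "Poly_Mapping.keys (d - \<beta> i) \<union> Poly_Mapping.keys (\<beta> i) = Poly_Mapping.keys d"
    using diff_in_Nn_add_diff[OF assms] by (metis keys_add_expo sup_commute)
  then show ?thesis by (simp add: standard_def)
qed

text \<open>Elimination from the top entry downwards: an entry at a leading position is cleared by a
  relation, any other entry is moved into the remainder \<open>r\<close>.\<close>

lemma relations_reduce:
  assumes "\<And>j. m \<le> j \<Longrightarrow> u j = 0"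
  shows "\<exists>r. (\<lambda>j. u j - r j) \<in> relations \<sigma> \<and> (\<forall>j. r j \<noteq> 0 \<longrightarrow> j < m \<and> j \<notin> leading \<sigma>)"
  using assms
proof (induction m arbitrary: u)
  case 0
  then show ?case using relations_zero by (intro exI[of _ "\<lambda>_. 0"]) auto
next
  case (Suc m)
  show ?case
  proof (cases "m \<in> leading \<sigma>")
    case True
    then obtain w where w: "w \<in> relations \<sigma>" "w m = 1" "\<forall>j>m. w j = 0" by (auto simp: leading_def)
    \<comment> \<open>Since \<open>w\<close> is 1 at \<open>m\<close> and 0 above, subtracting
      \<open>u m\<close> times \<open>w\<close> clears entry \<open>m\<close> and leaves the zeros
      above it.\<close>
    have "u j - u m * w j = 0" if "m \<le> j" for j
      using Suc.prems w that by (cases "j = m") auto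
    from Suc.IH[of "\<lambda>j. u j - u m * w j", OF this] obtain r where
      r: "(\<lambda>j. u j - u m * w j - r j) \<in> relations \<sigma>" "\<forall>j. r j \<noteq> 0 \<longrightarrow> j < m \<and> j \<notin> leading \<sigma>"
      by auto
    from relations_add_smult[OF r(1) w(1), of "u m"] have "(\<lambda>j. u j - r j) \<in> relations \<sigma>"
      by (simp add: algebra_simps)
    with r(2) less_SucI show ?thesis by blast
  next
    case False
    have "(u(m := 0)) j = 0" if "m \<le> j" for j using Suc.prems that by auto
    from Suc.IH[of "u(m := 0)", OF this] obtain r where
      r: "(\<lambda>j. (u(m := 0)) j - r j) \<in> relations \<sigma>" "\<forall>j. r j \<noteq> 0 \<longrightarrow> j < m \<and> j \<notin> leading \<sigma>"
      by auto
    \<comment> \<open>The remainder obtained by induction lives below \<open>m\<close>, so slot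
      \<open>m\<close> is free to receive \<open>u m\<close>.\<close>
    then have "r m = 0" by auto
    then have "(\<lambda>j. (u(m := 0)) j - r j) = (\<lambda>j. u j - (r(m := u m)) j)" by auto
    with r(1) have "(\<lambda>j. u j - (r(m := u m)) j) \<in> relations \<sigma>" by simp
    moreover have "(r(m := u m)) j \<noteq> 0 \<longrightarrow> j < Suc m \<and> j \<notin> leading \<sigma>" for j
      using r(2) False less_SucI by auto
    ultimately show ?thesis by blast
  qed
qed

text \<open>A relation with last entry 1 at \<open>i\<close> expresses the unit vector at
  \<open>i\<close> through lower positions; reducing that expression leaves only positions that are
  not leading.\<close>

lemma relations_straighten:
  assumes "i \<in> leading (Poly_Mapping.keys d)"
  obtains r where "(\<lambda>j. (if j = i then 1 else 0) - r j) \<in> relations (Poly_Mapping.keys d)"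
    and "\<forall>j. r j \<noteq> 0 \<longrightarrow> j < i \<and> diff_in_Nn d (\<beta> j) \<and> Poly_Mapping.keys (d - \<beta> j) \<in> standard j"
proof -
  from assms obtain w where w: "w \<in> relations (Poly_Mapping.keys d)" "w i = 1" "\<forall>j>i. w j = 0"
    by (auto simp: leading_def)
  define u where "u = (\<lambda>j. (if j = i then 1 else 0) - w j)"
  have "u j = 0" if "i \<le> j" for j using w that by (cases "j = i") (auto simp: u_def)
  then obtain r where r: "(\<lambda>j. u j - r j) \<in> relations (Poly_Mapping.keys d)"
    and r_supp: "\<forall>j. r j \<noteq> 0 \<longrightarrow> j < i \<and> j \<notin> leading (Poly_Mapping.keys d)"
    using relations_reduce by metis
  have rel: "(\<lambda>j. (if j = i then 1 else 0) - r j) \<in> relations (Poly_Mapping.keys d)"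
    using relations_add_smult[OF r w(1), of 1] by (simp add: u_def algebra_simps)
  show thesis
  proof (rule that[OF rel], intro allI impI)
    fix j assume j: "r j \<noteq> 0"
    with r_supp have "j < i" "j \<notin> leading (Poly_Mapping.keys d)" by auto
    moreover from this have "diff_in_Nn d (\<beta> j)"
      using relations_support[OF rel, of j] j by auto
    ultimately show "j < i \<and> diff_in_Nn d (\<beta> j) \<and> Poly_Mapping.keys (d - \<beta> j) \<in> standard j"
      by (simp add: mem_standard_iff)
  qed
qed

section \<open>The image of the matrix, degree by degree\<close>

lemma dim_A [simp]: "dim_row A = s" "dim_col A = l"
  by (simp_all add: monomial_mat_def)

lemma A_mult_vec:
  assumes "w \<in> carrier_vec l" "i < s"
  shows "(A *\<^sub>v w) $ i = (\<Sum>j<l. Poly_Mapping.single (\<alpha> i j) (c i j) * w $ j)"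
  using assms by (simp add: scalar_prod_def monomial_mat_def atLeast0LessThan)

text \<open>By \<gamma> j = \<alpha> i j + \<beta> i, the degree \<open>d\<close> part of A w only
  involves the coefficients of the entries w_j at \<open>d - \<gamma> j\<close>, so it is a
  combination of columns of the coefficient matrix.\<close>

lemma image_component:
  assumes "g \<in> image_mat A"
  shows "(\<lambda>i. if i < s \<and> diff_in_Nn d (\<beta> i) then Poly_Mapping.lookup (g $ i) (d - \<beta> i) else 0)
    \<in> relations (Poly_Mapping.keys d)"
proof -
  from assms obtain w where w: "w \<in> carrier_vec l" "g = A *\<^sub>v w" by (auto simp: image_mat_def)
  \<comment> \<open>Without the guard, the truncated \<open>d - \<gamma> j\<close> would pick up a
    coefficient from another degree.\<close>
  define x where "x j = (if Poly_Mapping.keys (\<gamma> j) \<subseteq> Poly_Mapping.keys d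
    then Poly_Mapping.lookup (w $ j) (d - \<gamma> j) else 0)" for j
  have summand: "(if diff_in_Nn d (\<beta> i)
      then Poly_Mapping.lookup (Poly_Mapping.single (\<alpha> i j) (c i j) * w $ j) (d - \<beta> i) else 0) = c i j * x j"
    if ij: "i < s" "j < l" for i j
  proof (cases "c i j = 0")
    case False
    then have \<gamma>: "\<gamma> j = \<alpha> i j + \<beta> i" using ij by (rule_tac solution_eq)
    have "diff_in_Nn d (\<gamma> j) \<longleftrightarrow> diff_in_Nn d (\<beta> i) \<and> diff_in_Nn (d - \<beta> i) (\<alpha> i j)"
      unfolding \<gamma> diff_in_Nn_def lookup_add lookup_minus
      by (metis add_leD2 add_le_imp_le_diff le_diff_conv2)
    moreover have "d - \<beta> i - \<alpha> i j = d - \<gamma> j"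
      by (rule poly_mapping_eqI) (simp add: \<gamma> lookup_add lookup_minus)
    ultimately show ?thesis
      using ij by (auto simp: lookup_single_mult x_def \<gamma>_le_iff[symmetric])
  qed simp
  have "(if diff_in_Nn d (\<beta> i) then Poly_Mapping.lookup (g $ i) (d - \<beta> i) else 0) =
      (\<Sum>j<l. c i j * x j)"
    if "i < s" for i
  proof -
    have "(if diff_in_Nn d (\<beta> i) then Poly_Mapping.lookup (g $ i) (d - \<beta> i) else 0) =
      (\<Sum>j<l. if diff_in_Nn d (\<beta> i)
        then Poly_Mapping.lookup (Poly_Mapping.single (\<alpha> i j) (c i j) * w $ j) (d - \<beta> i) else 0)"
      using that w by (simp add: A_mult_vec lookup_sum del: index_mult_mat_vec)
    also have "\<dots> = (\<Sum>j<l. c i j * x j)"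
      using that by (intro sum.cong refl summand) auto
    finally show ?thesis .
  qed
  then show ?thesis by (intro relationsI[of x]) (auto simp: x_def split: if_splits)
qed

text \<open>Converse of \<open>image_component\<close>: column coefficients \<open>x j\<close> lift
  to the homogeneous preimage with entries x_j x^(d - \<gamma> j). Where \<beta> i is not below
  \<open>d\<close>, the entry \<open>u i\<close> is 0 and the truncated exponent is
  harmless.\<close>

lemma relation_in_image:
  assumes "u \<in> relations (Poly_Mapping.keys d)"
  shows "vec s (\<lambda>i. Poly_Mapping.single (d - \<beta> i) (u i)) \<in> image_mat A"
proof -
  obtain x where x: "\<forall>j<l. x j \<noteq> 0 \<longrightarrow> Poly_Mapping.keys (\<gamma> j) \<subseteq> Poly_Mapping.keys d"
    "\<forall>i. u i = (if i < s then \<Sum>j<l. c i j * x j else 0)"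
    using assms by (rule relationsE)
  define w where "w = vec l (\<lambda>j. Poly_Mapping.single (d - \<gamma> j) (x j))"
  have w: "w \<in> carrier_vec l" by (simp add: w_def)
  have summand: "Poly_Mapping.single (\<alpha> i j) (c i j) * w $ j = Poly_Mapping.single (d - \<beta> i) (c i j * x j)"
    if ij: "i < s" "j < l" for i j
  proof (cases "c i j * x j = 0")
    case False
    then have "\<gamma> j = \<alpha> i j + \<beta> i" "diff_in_Nn d (\<gamma> j)"
      using ij x(1)[rule_format, of j] solution_eq[of i j] \<gamma>_le_iff[of j d] by simp_all
    then have "\<alpha> i j + (d - \<gamma> j) = d - \<beta> i"
      by (intro poly_mapping_eqI) (auto simp: diff_in_Nn_def lookup_add lookup_minus)
    then show ?thesis using ij by (simp add: w_def mult_single)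
  qed (use ij in \<open>auto simp: w_def mult_single\<close>)
  have "A *\<^sub>v w = vec s (\<lambda>i. Poly_Mapping.single (d - \<beta> i) (u i))"
  proof (rule eq_vecI)
    fix i assume "i < dim_vec (vec s (\<lambda>i. Poly_Mapping.single (d - \<beta> i) (u i)))"
    then have i: "i < s" by simp
    have "(A *\<^sub>v w) $ i = (\<Sum>j<l. Poly_Mapping.single (d - \<beta> i) (c i j * x j))"
      unfolding A_mult_vec[OF w i] using i by (intro sum.cong refl summand) auto
    then show "(A *\<^sub>v w) $ i = vec s (\<lambda>i. Poly_Mapping.single (d - \<beta> i) (u i)) $ i"
      using i by (simp add: x(2) single_sum)
  qed simp
  then show ?thesis using imageI[OF w, of "(*\<^sub>v) A"] by (simp add: image_mat_def)
qed

text \<open>A nonzero element of the image has a nonzero component in some degree. This is a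
  relation, and its last nonzero position is leading, so the monomial found there is not
  standard.\<close>

lemma image_standard_zero:
  assumes g: "g \<in> image_mat A"
    and std: "\<And>i b. i < s \<Longrightarrow> b \<in> Poly_Mapping.keys (g $ i) \<Longrightarrow> Poly_Mapping.keys b \<in> standard i"
  shows "g = 0\<^sub>v s"
proof (rule ccontr)
  assume "g \<noteq> 0\<^sub>v s"
  moreover have "g \<in> carrier_vec s" using image_mat_carrier[OF g] by simp
  ultimately obtain i where i: "i < s" "g $ i \<noteq> 0" by (metis eq_vecI carrier_vecD index_zero_vec)
  then obtain b where b: "Poly_Mapping.lookup (g $ i) b \<noteq> 0" by (metis lookup_zero poly_mapping_eqI)
  \<comment> \<open>The degree of the monomial x^b v_i, which occurs in \<open>g\<close>.\<close>
  define d where "d = b + \<beta> i"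
  define u where "u j = (if j < s \<and> diff_in_Nn d (\<beta> j) then Poly_Mapping.lookup (g $ j) (d - \<beta> j) else 0)" for j
  have u: "u \<in> relations (Poly_Mapping.keys d)"
    using image_component[OF g, of d] by (simp add: u_def[abs_def])
  have "d - \<beta> i = b" by (simp add: d_def)
  then have "u i \<noteq> 0" using i b by (simp add: u_def d_def diff_in_Nn_add)
  define m where "m = Max {j. u j \<noteq> 0}"
  have fin: "finite {j. u j \<noteq> 0}"
    by (rule finite_subset[of _ "{..<s}"]) (auto simp: u_def)
  have m: "u m \<noteq> 0" using Max_in[OF fin] \<open>u i \<noteq> 0\<close> by (auto simp: m_def)
  have top: "u j = 0" if "j > m" for j using Max_ge[OF fin, of j] that by (force simp: m_def)
  \<comment> \<open>Rescaling makes the last nonzero entry equal to 1, as \<open>leading\<close>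
    demands.\<close>
  have "(\<lambda>j. 0 + inverse (u m) * u j) \<in> relations (Poly_Mapping.keys d)"
    by (rule relations_add_smult[OF relations_zero u])
  then have "m \<in> leading (Poly_Mapping.keys d)"
    using m top unfolding leading_def by (intro CollectI bexI) auto
  moreover have md: "m < s" "diff_in_Nn d (\<beta> m)" "Poly_Mapping.lookup (g $ m) (d - \<beta> m) \<noteq> 0"
    using m by (auto simp: u_def split: if_splits)
  ultimately show False using std[of m "d - \<beta> m"] mem_standard_iff[of d m] by (simp add: in_keys_iff)
qed

section \<open>Standard representatives of cokernel classes\<close>

definition standard_vec :: "('n, 'k) mpol vec \<Rightarrow> bool" where
  "standard_vec g \<longleftrightarrow> g \<in> carrier_vec s \<and>
    (\<forall>i<s. \<forall>b\<in>Poly_Mapping.keys (g $ i). Poly_Mapping.keys b \<in> standard i)"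

text \<open>The monomials of g - h occur in \<open>g\<close> or in \<open>h\<close>, so the
  difference is a standard element of the image and vanishes. Each class thus has at most one
  standard representative.\<close>

lemma coker_class_inj:
  assumes g: "standard_vec g" and h: "standard_vec h" and eq: "coker_class A g = coker_class A h"
  shows "g = h"
proof -
  have c: "g \<in> carrier_vec s" "h \<in> carrier_vec s" using g h by (auto simp: standard_vec_def)
  then have "g - h \<in> image_mat A" using eq by (simp add: coker_class_eq_iff)
  then have "g - h = 0\<^sub>v s"
  proof (rule image_standard_zero)
    fix i b assume i: "i < s" and "b \<in> Poly_Mapping.keys ((g - h) $ i)"
    then have "b \<in> Poly_Mapping.keys (g $ i) \<or> b \<in> Poly_Mapping.keys (h $ i)"
      using c by (auto simp: in_keys_iff lookup_minus)
    then show "Poly_Mapping.keys b \<in> standard i" using g h i by (auto simp: standard_vec_def)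
  qed
  then have "(g - h) $ i = 0" if "i < s" for i using that by simp
  then show ?thesis using c by (intro eq_vecI) auto
qed

definition index :: "(nat \<times> 'n expo) set" where
  "index = {(i, b). i < s \<and> Poly_Mapping.keys b \<in> standard i}"

lemma standard_vec_monomials:
  assumes "F \<subseteq> index"
  shows "standard_vec (vec s (\<lambda>k. \<Sum>x\<in>F. if fst x = k then Poly_Mapping.single (snd x) (r x) else 0))"
  unfolding standard_vec_def
proof (intro conjI allI impI ballI)
  fix i b assume i: "i < s"
    and "b \<in> Poly_Mapping.keys
      (vec s (\<lambda>k. \<Sum>x\<in>F. if fst x = k then Poly_Mapping.single (snd x) (r x) else 0) $ i)"
  then have "(\<Sum>x\<in>F. Poly_Mapping.lookup (if fst x = i then Poly_Mapping.single (snd x) (r x) else 0) b) \<noteq> 0"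
    by (simp add: in_keys_iff lookup_sum)
  then obtain x where "x \<in> F"
    "Poly_Mapping.lookup (if fst x = i then Poly_Mapping.single (snd x) (r x) else 0) b \<noteq> 0"
    by (rule sum.not_neutral_contains_not_neutral)
  then have "x \<in> F" "fst x = i" "snd x = b" by (auto simp: lookup_single when_def split: if_splits)
  then show "Poly_Mapping.keys b \<in> standard i" using assms by (auto simp: index_def)
qed simp

text \<open>Different pairs give different monomials, so no other term of the sum contributes to
  this coefficient.\<close>

lemma monomial_lookup:
  assumes "finite F" "(i, b) \<in> F" "i < s"
  shows "Poly_Mapping.lookup
    (vec s (\<lambda>k. \<Sum>x\<in>F. if fst x = k then Poly_Mapping.single (snd x) (r x) else 0) $ i) b = r (i, b)"
proof -
  have "Poly_Mapping.lookup
      (vec s (\<lambda>k. \<Sum>x\<in>F. if fst x = k then Poly_Mapping.single (snd x) (r x) else 0) $ i) b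
    = (\<Sum>x\<in>F. if x = (i, b) then r x else 0)"
    using assms(3) by (auto simp: lookup_sum lookup_single when_def intro!: sum.cong)
  then show ?thesis using assms by simp
qed

lemma mono_class_inj: "inj_on (\<lambda>(i, b). mono_class A b i) index"
proof (rule inj_onI, clarify)
  fix i b i' b' assume mem: "(i, b) \<in> index" "(i', b') \<in> index"
    and eq: "mono_class A b i = mono_class A b' i'"
  let ?g = "\<lambda>i b. Poly_Mapping.single b 1 \<cdot>\<^sub>v unit_vec s i :: ('n, 'k) mpol vec"
  have "standard_vec (?g i b)" if "(i, b) \<in> index" for i b
    using that by (auto simp: standard_vec_def index_def unit_vec_def split: if_splits)
  then have "?g i b = ?g i' b'" using mem eq by (intro coker_class_inj) (simp_all add: mono_class_def)
  then have "?g i b $ i = ?g i' b' $ i" by simp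
  then have "Poly_Mapping.single b (1 :: 'k) = (if i = i' then Poly_Mapping.single b' 1 else 0)"
    using mem by (auto simp: index_def unit_vec_def)
  \<comment> \<open>The left side is 1, and the right side is nonzero only if both the rows and the
    exponents agree.\<close>
  then have "Poly_Mapping.lookup (Poly_Mapping.single b (1 :: 'k)) b =
    Poly_Mapping.lookup (if i = i' then Poly_Mapping.single b' 1 else 0) b" by simp
  then show "i = i' \<and> b = b'" by (auto simp: lookup_single when_def split: if_splits)
qed

section \<open>Straightening of nonstandard monomials\<close>

lemma finsum_lower:
  assumes i: "i < s"
  shows "finsum (coker_vs A) (\<lambda>j. r j \<odot>\<^bsub>coker_vs A\<^esub> mono_class A (b j) j) {j. j < i \<and> r j \<noteq> 0} =
    coker_class A (vec s (\<lambda>k. if k < i then Poly_Mapping.single (b k) (r k) else 0))"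
proof -
  have "(\<Sum>j\<in>{j. j < i \<and> r j \<noteq> 0}. if j = k then Poly_Mapping.single (b j) (r j) else 0) =
    (if k < i then Poly_Mapping.single (b k) (r k) else 0)" for k
    by (simp add: sum.delta')
  then show ?thesis
    using finsum_mono_class[of "{j. j < i \<and> r j \<noteq> 0}" "\<lambda>j. j" A r b] i by simp
qed

text \<open>In degree a + \<beta> i the hypothesis says that \<open>i\<close> is leading. The
  resulting relation, lifted to the image, is x^a v_i minus its straightened form.\<close>

lemma mono_class_straighten:
  assumes i: "i < s" and a: "Poly_Mapping.keys a \<notin> standard i"
  obtains r where
    "\<forall>j. r j \<noteq> 0 \<longrightarrow> j < i \<and> diff_in_Nn (a + \<beta> i) (\<beta> j) \<and> Poly_Mapping.keys (a + \<beta> i - \<beta> j) \<in> standard j"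
    and "mono_class A a i = coker_class A
      (vec s (\<lambda>k. if k < i then Poly_Mapping.single (a + \<beta> i - \<beta> k) (r k) else 0))"
proof -
  from a have "i \<in> leading (Poly_Mapping.keys (a + \<beta> i))"
    by (simp add: standard_def keys_add_expo)
  then obtain r where
    rel: "(\<lambda>j. (if j = i then 1 else 0) - r j) \<in> relations (Poly_Mapping.keys (a + \<beta> i))" and
    r: "\<forall>j. r j \<noteq> 0 \<longrightarrow> j < i \<and> diff_in_Nn (a + \<beta> i) (\<beta> j) \<and> Poly_Mapping.keys (a + \<beta> i - \<beta> j) \<in> standard j"
    by (rule relations_straighten)
  let ?h = "vec s (\<lambda>k. if k < i then Poly_Mapping.single (a + \<beta> i - \<beta> k) (r k) else 0)"
  \<comment> \<open>Cutting \<open>?h\<close> off at row \<open>i\<close> therefore drops no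
    term.\<close>
  have upper: "r j = 0" if "i \<le> j" for j using r that leD by blast
  have "Poly_Mapping.single a 1 \<cdot>\<^sub>v unit_vec s i - ?h =
    vec s (\<lambda>j. Poly_Mapping.single (a + \<beta> i - \<beta> j) ((if j = i then 1 else 0) - r j))"
    using upper by (intro eq_vecI) (auto simp: unit_vec_def single_diff single_uminus not_less)
  then have "Poly_Mapping.single a 1 \<cdot>\<^sub>v unit_vec s i - ?h \<in> image_mat A"
    using relation_in_image[OF rel] by simp
  then have "mono_class A a i = coker_class A ?h"
    unfolding mono_class_def by (subst coker_class_eq_iff) auto
  with r show thesis by (rule that)
qed

section \<open>The standard basis and uniqueness of the straightening coefficients\<close>

lemma mono_class_basis: "vectorspace.basis class_ring (coker_vs A) ((\<lambda>(i, b). mono_class A b i) ` index)"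
proof -
  interpret V: vectorspace class_ring "coker_vs A" by (rule vectorspace_coker_vs)
  define f where "f = (\<lambda>(i, b). mono_class A b i)"
  let ?B = "f ` index"
  have inj: "inj_on f index" unfolding f_def by (rule mono_class_inj)
  have mono: "mono_class A b i \<in> carrier (coker_vs A)" if "i < s" for b i
    using that by (auto simp: carrier_coker_vs mono_class_def)
  have carr: "?B \<subseteq> carrier (coker_vs A)" by (auto simp: f_def index_def mono)
  have "\<not> V.lin_dep ?B"
  proof
    assume "V.lin_dep ?B"
    then obtain C r v where C: "finite C" "C \<subseteq> ?B" "V.lincomb r C = \<zero>\<^bsub>coker_vs A\<^esub>" "v \<in> C" "r v \<noteq> 0"
      by (auto simp: V.lin_dep_def)
    \<comment> \<open>A set of classes is traded for a set of pairs, so that the dependence becomes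
      an equation between standard vectors.\<close>
    then obtain F where F: "F \<subseteq> index" "C = f ` F" by (auto simp: subset_image_iff)
    have injF: "inj_on f F" using inj F(1) inj_on_subset by blast
    then have finF: "finite F" using C(1) F(2) finite_imageD by blast
    have "V.lincomb r C = finsum (coker_vs A) (\<lambda>x. r (f x) \<odot>\<^bsub>coker_vs A\<^esub> f x) F"
      unfolding V.lincomb_def F(2)
      using F(1) carr by (intro V.finsum_reindex[OF _ injF]) (auto intro!: V.smult_closed)
    also have "\<dots> = finsum (coker_vs A) (\<lambda>x. r (f x) \<odot>\<^bsub>coker_vs A\<^esub> mono_class A (snd x) (fst x)) F"
      by (simp add: f_def case_prod_unfold)
    also have "\<dots> = coker_class A
        (vec s (\<lambda>k. \<Sum>x\<in>F. if fst x = k then Poly_Mapping.single (snd x) (r (f x)) else 0))"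
      using F(1) by (subst finsum_mono_class[OF finF]) (auto simp: index_def)
    finally have "coker_class A
        (vec s (\<lambda>k. \<Sum>x\<in>F. if fst x = k then Poly_Mapping.single (snd x) (r (f x)) else 0)) =
        coker_class A (0\<^sub>v s)"
      using C(3) by (simp add: zero_coker_vs)
    then have zero: "vec s (\<lambda>k. \<Sum>x\<in>F. if fst x = k then Poly_Mapping.single (snd x) (r (f x)) else 0) = 0\<^sub>v s"
      by (rule coker_class_inj[OF standard_vec_monomials[OF F(1)], rotated]) (simp add: standard_vec_def)
    \<comment> \<open>The coefficient of x^b in entry \<open>i\<close> of the zero vector is
      \<open>r v\<close>, which is nonzero by assumption.\<close>
    from C(4) F(2) obtain i b where ib: "(i, b) \<in> F" "v = f (i, b)" by auto
    then have "i < s" using F(1) by (auto simp: index_def)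
    with monomial_lookup[OF finF ib(1), of "\<lambda>x. r (f x)"] zero ib C(5) show False by simp
  qed
  moreover have "V.span ?B = carrier (coker_vs A)"
  proof
    show "V.span ?B \<subseteq> carrier (coker_vs A)" using V.span_is_subset2[OF carr] .
    interpret S: LinearCombinations.submodule class_ring "V.span ?B" "coker_vs A"
      by (rule V.span_is_submodule[OF carr])
    have std: "mono_class A b i \<in> V.span ?B" if "(i, b) \<in> index" for i b
    proof -
      have "f (i, b) \<in> V.span ?B" using V.in_own_span[OF carr] imageI[OF that, of f] by (rule subsetD)
      then show ?thesis by (simp add: f_def)
    qed
    note finsum_span = submodule_finsum_closed[OF S.submodule_axioms]
    \<comment> \<open>One straightening suffices, without induction, because its right-hand side is
      already standard.\<close>
    have mono_span: "mono_class A b i \<in> V.span ?B" if i: "i < s" for i b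
    proof (cases "Poly_Mapping.keys b \<in> standard i")
      case True
      then show ?thesis using i by (intro std) (simp add: index_def)
    next
      case False
      then obtain r where
        r: "\<forall>j. r j \<noteq> 0 \<longrightarrow> j < i \<and> diff_in_Nn (b + \<beta> i) (\<beta> j) \<and> Poly_Mapping.keys (b + \<beta> i - \<beta> j) \<in> standard j"
        and eq: "mono_class A b i = coker_class A
          (vec s (\<lambda>k. if k < i then Poly_Mapping.single (b + \<beta> i - \<beta> k) (r k) else 0))"
        by (rule mono_class_straighten[OF i])
      have "finsum (coker_vs A) (\<lambda>j. r j \<odot>\<^bsub>coker_vs A\<^esub> mono_class A (b + \<beta> i - \<beta> j) j) {j. j < i \<and> r j \<noteq> 0} \<in> V.span ?B"
        using r i by (intro finsum_span S.smult_closed std) (force simp: index_def)+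
      then show ?thesis unfolding eq finsum_lower[OF i] .
    qed
    show "carrier (coker_vs A) \<subseteq> V.span ?B"
    proof
      fix X assume "X \<in> carrier (coker_vs A)"
      then obtain g where g: "g \<in> carrier_vec (dim_row A)" "X = coker_class A g"
        by (auto simp: carrier_coker_vs)
      show "X \<in> V.span ?B"
        unfolding g(2) coker_class_as_finsum[OF g(1)]
        by (rule finsum_span) (auto intro!: S.smult_closed mono_span)
    qed
  qed
  ultimately show ?thesis unfolding V.basis_def f_def[symmetric] using carr by simp
qed

text \<open>Admissible coefficients yield a standard representative of the class, and there is only
  one. Taking \<open>r\<close> of dimension \<open>i\<close> leaves no irrelevant values that could
  spoil uniqueness.\<close>

lemma mono_class_straighten_unique:
  assumes i: "i < s" and a: "Poly_Mapping.keys a \<notin> standard i"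
  shows "\<exists>!r. r \<in> carrier_vec i \<and>
    (\<forall>j<i. \<not> diff_in_Nn (a + \<beta> i) (\<beta> j) \<or> Poly_Mapping.keys (a + \<beta> i - \<beta> j) \<notin> standard j \<longrightarrow> r $ j = 0) \<and>
    mono_class A a i = finsum (coker_vs A)
      (\<lambda>j. r $ j \<odot>\<^bsub>coker_vs A\<^esub> mono_class A (a + \<beta> i - \<beta> j) j) {j. j < i \<and> r $ j \<noteq> 0}"
    (is "\<exists>!r. ?P r")
proof -
  let ?h = "\<lambda>r. vec s (\<lambda>k. if k < i then Poly_Mapping.single (a + \<beta> i - \<beta> k) (r $ k) else 0)"
  have P: "?P r \<longleftrightarrow> r \<in> carrier_vec i \<and>
    (\<forall>j<i. \<not> diff_in_Nn (a + \<beta> i) (\<beta> j) \<or> Poly_Mapping.keys (a + \<beta> i - \<beta> j) \<notin> standard j \<longrightarrow> r $ j = 0) \<and>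
    mono_class A a i = coker_class A (?h r)" for r
    using finsum_lower[OF i, of "($) r" "\<lambda>j. a + \<beta> i - \<beta> j"] by simp
  \<comment> \<open>The vanishing condition removes exactly the terms that would not be
    standard.\<close>
  have std: "standard_vec (?h r)" if "?P r" for r
    using that unfolding P standard_vec_def by (auto split: if_splits)
  have class_eq: "mono_class A a i = coker_class A (?h r)" if "?P r" for r
    using that unfolding P by (elim conjE)
  obtain r where r: "\<forall>j. r j \<noteq> 0 \<longrightarrow> j < i \<and> diff_in_Nn (a + \<beta> i) (\<beta> j) \<and> Poly_Mapping.keys (a + \<beta> i - \<beta> j) \<in> standard j"
    and eq: "mono_class A a i = coker_class A
      (vec s (\<lambda>k. if k < i then Poly_Mapping.single (a + \<beta> i - \<beta> k) (r k) else 0))"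
    by (rule mono_class_straighten[OF i a])
  have "?h (vec i r) = vec s (\<lambda>k. if k < i then Poly_Mapping.single (a + \<beta> i - \<beta> k) (r k) else 0)"
    by (intro eq_vecI) auto
  then have ex: "?P (vec i r)" unfolding P using r by (auto simp: eq)
  have uniq: "r = r'" if r: "?P r" and r': "?P r'" for r r'
  proof (rule eq_vecI)
    have dim: "dim_vec r = i" "dim_vec r' = i"
      using r r' by (blast intro: carrier_vecD)+
    then show "dim_vec r = dim_vec r'" by simp
    have "coker_class A (?h r) = coker_class A (?h r')"
      using class_eq[OF r] class_eq[OF r'] by (rule trans[OF sym])
    then have eq: "?h r = ?h r'" by (rule coker_class_inj[OF std[OF r] std[OF r']])
    fix k assume "k < dim_vec r'"
    then have k: "k < i" using dim by simp
    from eq have "?h r $ k = ?h r' $ k" by (rule arg_cong)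
    then have "Poly_Mapping.single (a + \<beta> i - \<beta> k) (r $ k) = Poly_Mapping.single (a + \<beta> i - \<beta> k) (r' $ k)"
      using k i by simp
    then show "r $ k = r' $ k" by (rule injD[OF inj_single])
  qed
  show ?thesis by (rule ex1I[of ?P "vec i r", OF ex uniq[OF _ ex]])
qed

end

theorem corollary2p4:
  fixes s l :: nat
    and c :: "nat \<Rightarrow> nat \<Rightarrow> 'k::field_char_0"
    and \<alpha> :: "nat \<Rightarrow> nat \<Rightarrow> 'n::finite expo"
    and \<gamma> \<beta> :: "nat \<Rightarrow> 'n expo"
  defines "A \<equiv> monomial_mat s l c \<alpha>"
  assumes "multigraded_mat A"
    and "squarefree_mat s l c \<alpha>"
    and "squarefree_solution s l c \<alpha> \<gamma> \<beta>"
  shows "\<exists>\<Delta> :: nat \<Rightarrow> 'n set set.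
    (\<forall>i<s. simplicial_complex (\<Delta> i)) \<and>
    \<comment> \<open>(1); injectivity says that the classes form a basis as a family indexed by \<open>(i, b)\<close>\<close>
    (let Idx = {(i, b). i < s \<and> Poly_Mapping.keys b \<in> \<Delta> i} in
       inj_on (\<lambda>(i, b). mono_class A b i) Idx \<and>
       vectorspace.basis class_ring (coker_vs A) ((\<lambda>(i, b). mono_class A b i) ` Idx)) \<and>
    \<comment> \<open>(2)\<close>
    (\<forall>i<s. \<forall>a :: 'n expo. Poly_Mapping.keys a \<notin> \<Delta> i \<longrightarrow>
       (\<exists>!r :: 'k vec. r \<in> carrier_vec i \<and>
          (\<forall>j<i. \<not> diff_in_Nn (a + \<beta> i) (\<beta> j) \<or> Poly_Mapping.keys (a + \<beta> i - \<beta> j) \<notin> \<Delta> j \<longrightarrow> r $ j = 0) \<and>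
          mono_class A a i =
            finsum (coker_vs A)
              (\<lambda>j. r $ j \<odot>\<^bsub>coker_vs A\<^esub> mono_class A (a + \<beta> i - \<beta> j) j)
              {j. j < i \<and> r $ j \<noteq> 0}))"
proof -
  interpret squarefree_presentation s l c \<alpha> \<gamma> \<beta> by unfold_locales fact
  show ?thesis
    unfolding assms(1) Let_def
    using simplicial_complex_standard mono_class_inj[unfolded index_def]
      mono_class_basis[unfolded index_def] mono_class_straighten_unique
    by (intro exI[of _ standard] conjI allI impI)
qed

end
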